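(* Suppose $\boldsymbol\xi\sim P$ satisfies density-level regular variation with limit $\varphi^\star$, let $(L_1,\dots,L_K)\in\mathcal H_1(L_1^\star,\dots,L_K^\star)$ be regular, and let $\mathcal J\in\mathfrak J$ be a nonempty subset of $[K]$ under consideration. Let $\{\boldsymbol\xi_u\}\in\mathcal D(P)$ with $\boldsymbol\xi_u\sim P_u$, and assume that for all sufficiently large $u$ the maxima defining $\mathcal Y_u(\mathcal J;P)$ and $\mathcal Y_u(\mathcal J;P_u)$ are attained. Then $$\limsup_{u\to\infty}\mathcal Y_u(\mathcal J;P)\subseteq\mathcal Y^\star(\mathcal J),\qquad\limsup_{u\to\infty}\mathcal Y_u(\mathcal J;P_u)\subseteq\mathcal Y^\star(\mathcal J),$$ $$\frac{\sup_{\boldsymbol z\in\Gamma_u(\mathcal J)}f_{P_u}(u\boldsymbol z)}{\sup_{\boldsymbol z\in\Gamma_u(\mathcal J)}f_P(u\boldsymbol z)}\to1\quad\text{as }u\to\infty.$$ If, in addition, $\mathcal Y^\star(\mathcal J)=\{\boldsymbol z^\star\}$, then any selections $\boldsymbol z_u\in\mathcal Y_u(\mathcal J;P)$ and $\tilde{\boldsymbol z}_u\in\mathcal Y_u(\mathcal J;P_u)$ satisfy $\boldsymbol z_u\to\boldsymbol z^\star$ and $\tilde{\boldsymbol z}_u\to\boldsymbol z^\star$ as $u\to\infty$.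
   Context: Setting. $\|\cdot\|$ is the Euclidean norm on $\mathbb R^d$; $\mathcal E\subset\mathbb R^d$ is a closed cone; $B_r=\{\boldsymbol z:\|\boldsymbol z\|\le r\}$. $\boldsymbol\xi\sim P$ is a random vector with density $f_P=f_{\boldsymbol\xi}$ supported on $\mathcal E$; for a law $Q$ on $\mathcal E$, $f_Q$ denotes its density. $[K]=\{1,\dots,K\}$. Density-level regular variation: $f_{\boldsymbol\xi}$ is continuous on $B_{r_0}^c\cap\mathcal E$ for some $r_0>0$, and there are $s>0$ and $\varphi^\star:\mathcal E\setminus\{\boldsymbol 0\}\to(0,\infty)$ with $t^{s+d}f_{\boldsymbol\xi}(t\boldsymbol z)\to\varphi^\star(\boldsymbol z)$ as $t\to\infty$, uniformly over compact subsets of $\mathcal E\setminus\{\boldsymbol 0\}$. Loss systems: measurable functions $L_1,\dots,L_K:\mathcal E\to\mathbb R$ form an asymptotically homogeneous multi-loss system, written $(L_1,\dots,L_K)\in\mathcal H_1(L_1^\star,\dots,L_K^\star)$, if for each $j$, $L_j^\star:\mathcal E\to\mathbb R$ satisfies $\{L_j^\star>0\}\ne\varnothing$ and $t^{-1}L_j(t\boldsymbol z_t)\to L_j^\star(\boldsymbol z)$ whenever $t\to\infty$ and $\boldsymbol z_t\to\boldsymbol z$ in $\mathcal E$. $\mathcal S(u;\mathcal J)=\{\boldsymbol z\in\mathcal E:L_j(\boldsymbol z)\ge u\ \forall j\in\mathcal J\}$, $\mathcal S^\star(\mathcal J)=\{\boldsymbol z\in\mathcal E:L_j^\star(\boldsymbol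 z)\ge1\ \forall j\in\mathcal J\}$. $\mathfrak J$ is the collection of nonempty subsets of $[K]$ under consideration; the system is regular if $\mathcal S^\star(\mathcal J)$ has nonzero Lebesgue measure for every $\mathcal J\in\mathfrak J$. Reverse-stress notation: $\Gamma_u(\mathcal J)=u^{-1}\mathcal S(u;\mathcal J)$, $\Psi_u^{(Q)}(\boldsymbol z)=u^{s+d}f_Q(u\boldsymbol z)$, $\mathcal Y_u(\mathcal J;Q)=\arg\max_{\boldsymbol z\in\Gamma_u(\mathcal J)}\Psi_u^{(Q)}(\boldsymbol z)$ (the full set of maximizers), and $\mathcal Y^\star(\mathcal J)=\arg\max_{\boldsymbol z\in\mathcal S^\star(\mathcal J)}\varphi^\star(\boldsymbol z)$. For a family of sets, $\limsup_{u\to\infty}A_u$ is the outer (Painlevé–Kuratowski) limit: all limits of sequences $\boldsymbol z_k\in A_{u_k}$ with $u_k\to\infty$. Density-preserving families: $\{\boldsymbol\xi_u\}\in\mathcal D(P)$, where $\boldsymbol\xi_u\sim P_u$ are laws on $\mathcal E$ with densities, if (D1) $\Psi_u^{(P_u)}(\boldsymbol z_u)\to\varphi^\star(\boldsymbol z)$ as $u\to\infty$ whenever $\boldsymbol z_u\to\boldsymbol z\in\mathcal E\setminus\{\boldsymbol0\}$ ($\boldsymbol z_u\in\mathcal E$); and (D2) $\lim_{M\to\infty}\limsup_{u\to\infty}\sup_{\boldsymbol z\in\mathcal E,\|\boldsymbol z\|\ge M}\Psi_u^{(P_u)}(\boldsymbol z)=0$. *)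

theory Defs
  imports "HOL-Probability.Probability"
begin

text \<open>
  Euclidean space is \<open>real ^ 'd\<close>, with dimension \<open>CARD('d)\<close>. The cone \<open>E\<close> is always a set, and
  functions on \<open>E\<close> are total functions of which only the values on \<open>E\<close> are used. A random vector
  enters only through its law \<open>Q\<close>; since pointwise values of densities matter, a law is accompanied
  by a fixed version \<open>f\<close> of its density.
\<close>

definition law_with_density_on ::
  "(real ^ 'd) set \<Rightarrow> (real ^ 'd) measure \<Rightarrow> (real ^ 'd \<Rightarrow> real) \<Rightarrow> bool" where
  "law_with_density_on E Q f \<longleftrightarrow>
     prob_space Q \<and> f \<in> borel_measurable borel \<and> (\<forall>z. 0 \<le> f z) \<and>
     Q = density lborel (\<lambda>z. ennreal (f z)) \<and> (AE z in Q. z \<in> E)"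

definition density_regular_variation ::
  "(real ^ 'd) set \<Rightarrow> (real ^ 'd \<Rightarrow> real) \<Rightarrow> real \<Rightarrow> (real ^ 'd \<Rightarrow> real) \<Rightarrow> bool" where
  "density_regular_variation E f s \<phi> \<longleftrightarrow>
     (\<exists>r\<^sub>0>0. continuous_on (E - cball 0 r\<^sub>0) f) \<and>
     s > 0 \<and> (\<forall>z\<in>E - {0}. \<phi> z > 0) \<and>
     (\<forall>C. compact C \<longrightarrow> C \<subseteq> E - {0} \<longrightarrow>
        uniform_limit C (\<lambda>t z. t powr (s + real CARD('d)) * f (t *\<^sub>R z)) \<phi> at_top)"

definition asymp_homogeneous_system ::
  "(real ^ 'd) set \<Rightarrow> nat \<Rightarrow> (nat \<Rightarrow> real ^ 'd \<Rightarrow> real) \<Rightarrow> (nat \<Rightarrow> real ^ 'd \<Rightarrow> real) \<Rightarrow> bool" where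
  "asymp_homogeneous_system E K L Lstar \<longleftrightarrow>
     (\<forall>j\<in>{1..K}.
        L j \<in> borel_measurable (restrict_space borel E) \<and>
        {z \<in> E. Lstar j z > 0} \<noteq> {} \<and>
        (\<forall>w z. (\<forall>t. w t \<in> E) \<longrightarrow> z \<in> E \<longrightarrow> (w \<longlongrightarrow> z) at_top \<longrightarrow>
           ((\<lambda>t::real. inverse t * L j (t *\<^sub>R w t)) \<longlongrightarrow> Lstar j z) at_top))"

definition stress_set ::
  "(real ^ 'd) set \<Rightarrow> (nat \<Rightarrow> real ^ 'd \<Rightarrow> real) \<Rightarrow> real \<Rightarrow> nat set \<Rightarrow> (real ^ 'd) set" where
  "stress_set E L u J = {z \<in> E. \<forall>j\<in>J. L j z \<ge> u}"

definition limit_stress_set ::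
  "(real ^ 'd) set \<Rightarrow> (nat \<Rightarrow> real ^ 'd \<Rightarrow> real) \<Rightarrow> nat set \<Rightarrow> (real ^ 'd) set" where
  "limit_stress_set E Lstar J = {z \<in> E. \<forall>j\<in>J. Lstar j z \<ge> 1}"

definition regular_system ::
  "(real ^ 'd) set \<Rightarrow> (nat \<Rightarrow> real ^ 'd \<Rightarrow> real) \<Rightarrow> nat set set \<Rightarrow> bool" where
  "regular_system E Lstar \<JJ> \<longleftrightarrow> (\<forall>J\<in>\<JJ>. emeasure lebesgue (limit_stress_set E Lstar J) \<noteq> 0)"

definition scaled_stress_set ::
  "(real ^ 'd) set \<Rightarrow> (nat \<Rightarrow> real ^ 'd \<Rightarrow> real) \<Rightarrow> real \<Rightarrow> nat set \<Rightarrow> (real ^ 'd) set" where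
  "scaled_stress_set E L u J = (\<lambda>z. inverse u *\<^sub>R z) ` stress_set E L u J"

definition scaled_density :: "real \<Rightarrow> (real ^ 'd \<Rightarrow> real) \<Rightarrow> real \<Rightarrow> real ^ 'd \<Rightarrow> real" where
  "scaled_density s f u z = u powr (s + real CARD('d)) * f (u *\<^sub>R z)"

definition argmax_set :: "'a set \<Rightarrow> ('a \<Rightarrow> real) \<Rightarrow> 'a set" where
  "argmax_set A g = {z. is_arg_max g (\<lambda>w. w \<in> A) z}"

definition stress_maximizers ::
  "(real ^ 'd) set \<Rightarrow> (nat \<Rightarrow> real ^ 'd \<Rightarrow> real) \<Rightarrow> real \<Rightarrow> (real ^ 'd \<Rightarrow> real) \<Rightarrow> real \<Rightarrow> nat set \<Rightarrow>
   (real ^ 'd) set" where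
  "stress_maximizers E L s f u J = argmax_set (scaled_stress_set E L u J) (scaled_density s f u)"

definition limit_maximizers ::
  "(real ^ 'd) set \<Rightarrow> (nat \<Rightarrow> real ^ 'd \<Rightarrow> real) \<Rightarrow> (real ^ 'd \<Rightarrow> real) \<Rightarrow> nat set \<Rightarrow>
   (real ^ 'd) set" where
  "limit_maximizers E Lstar \<phi> J = argmax_set (limit_stress_set E Lstar J) \<phi>"

definition outer_limit :: "(real \<Rightarrow> 'a::topological_space set) \<Rightarrow> 'a set" where
  "outer_limit A =
     {z. \<exists>u w. filterlim u at_top sequentially \<and> (\<forall>k. w k \<in> A (u k)) \<and> w \<longlonglongrightarrow> z}"

text \<open>
  The original law enters the following notion only through the index \<open>s\<close> and the limit \<open>\<phi>\<close> of its
  density. The family is indexed by \<open>u > 0\<close>. The supremum in the tail condition is taken in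
  \<open>ereal\<close>, because it may be infinite for small \<open>u\<close> or \<open>M\<close>.
\<close>

definition density_preserving ::
  "(real ^ 'd) set \<Rightarrow> real \<Rightarrow> (real ^ 'd \<Rightarrow> real) \<Rightarrow>
   (real \<Rightarrow> (real ^ 'd) measure) \<Rightarrow> (real \<Rightarrow> real ^ 'd \<Rightarrow> real) \<Rightarrow> bool" where
  "density_preserving E s \<phi> Pu fu \<longleftrightarrow>
     (\<forall>u>0. law_with_density_on E (Pu u) (fu u)) \<and>
     (\<forall>w z. (\<forall>u. w u \<in> E) \<longrightarrow> z \<in> E - {0} \<longrightarrow> (w \<longlongrightarrow> z) at_top \<longrightarrow>
        ((\<lambda>u. scaled_density s (fu u) u (w u)) \<longlongrightarrow> \<phi> z) at_top) \<and>
     ((\<lambda>M::real. Limsup at_top (\<lambda>u::real.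
         SUP z\<in>{z \<in> E. norm z \<ge> M}. ereal (scaled_density s (fu u) u z))) \<longlongrightarrow> 0) at_top"

end

theory Submission
  imports Defs
begin

text \<open>
  The rescaled densities converge continuously to \<open>\<phi>\<close> away from the origin and are tight at
  infinity; the original density has both properties too, by uniform convergence near a point and
  by rescaling to the unit sphere. The scaled stress sets have their outer limit in the limit stress
  set, which misses the origin, and every point of that set is approximated by points eventually
  lying in the scaled sets. Comparing maximizers with these approximations shows that every cluster
  point maximizes \<open>\<phi>\<close>; tightness bounds the maximizers, so every sequence has a cluster point
  and the maximal values converge to the positive maximum of \<open>\<phi>\<close>, for both families of densities.
\<close>

section \<open>Continuous convergence and limits along subsequences\<close>

text \<open>The definitions test convergence along functions \<open>w\<close> of a real parameter,
  while cluster points call for sequences; the product filter serves both. If the joint limit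
  failed, bad pairs with parameters tending to infinity and points tending to \<open>z\<close> could
  be threaded into a single admissible \<open>w\<close> violating \<open>conv\<close>.\<close>

lemma joint_limit:
  fixes H :: "real \<Rightarrow> 'a::metric_space \<Rightarrow> 'b::metric_space"
  assumes "z \<in> E"
    and conv: "\<And>w. \<lbrakk>\<And>t. w t \<in> E; (w \<longlongrightarrow> z) at_top\<rbrakk> \<Longrightarrow> ((\<lambda>t. H t (w t)) \<longlongrightarrow> l) at_top"
  shows "((\<lambda>(t, x). H t x) \<longlongrightarrow> l) (at_top \<times>\<^sub>F inf (nhds z) (principal E))"
proof (rule ccontr)
  assume "\<not> ?thesis"
  then obtain e where "e > 0"
    and e: "\<not> (\<forall>\<^sub>F p in at_top \<times>\<^sub>F inf (nhds z) (principal E). dist ((\<lambda>(t, x). H t x) p) l < e)"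
    unfolding tendsto_iff by blast
  have bad: "\<exists>t x. t > T \<and> x \<in> E \<and> dist x z < d \<and> dist (H t x) l \<ge> e" if "d > 0" for T d
  proof (rule ccontr)
    assume no: "\<not> ?thesis"
    have "\<forall>\<^sub>F t in at_top. t > T"
      by (rule eventually_gt_at_top)
    moreover have "\<forall>\<^sub>F x in inf (nhds z) (principal E). x \<in> E \<and> dist x z < d"
      using that unfolding eventually_inf_principal eventually_nhds_metric by auto
    ultimately have "\<forall>\<^sub>F p in at_top \<times>\<^sub>F inf (nhds z) (principal E).
        fst p > T \<and> snd p \<in> E \<and> dist (snd p) z < d"
      unfolding eventually_prod_filter by fastforce
    then have "\<forall>\<^sub>F p in at_top \<times>\<^sub>F inf (nhds z) (principal E). dist ((\<lambda>(t, x). H t x) p) l < e"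
      by eventually_elim (use no in \<open>auto simp: not_le\<close>)
    with e show False by simp
  qed
  \<comment> \<open>\<open>Q n p\<close> says that \<open>p\<close> is a bad pair at stage
    \<open>n\<close>. The dependent choice also makes the parameters strictly increase, so each
    parameter value determines its stage.\<close>
  define Q where "Q n p \<longleftrightarrow> fst p > real n \<and> snd p \<in> E \<and> dist (snd p) z < inverse (real (Suc n))
      \<and> dist (H (fst p) (snd p)) l \<ge> e" for n p
  have "\<exists>q. \<forall>n. Q n (q n) \<and> fst (q n) < fst (q (Suc n))"
  proof (rule dependent_nat_choice)
    show "\<exists>p. Q 0 p"
      using bad[of "inverse (real (Suc 0))" 0] unfolding Q_def by auto
    show "\<exists>p'. Q (Suc n) p' \<and> fst p < fst p'" for p n
      using bad[of "inverse (real (Suc (Suc n)))" "max (real (Suc n)) (fst p)"]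
      unfolding Q_def by auto
  qed
  then obtain q where q: "\<And>n. Q n (q n)" and mono: "\<And>n. fst (q n) < fst (q (Suc n))"
    by blast
  have sm: "strict_mono (\<lambda>n. fst (q n))"
    using mono by (simp add: strict_mono_Suc_iff)
  \<comment> \<open>The path visits the bad points at the chosen parameters. The default value
    \<open>z\<close> elsewhere stays in \<open>E\<close> and does not disturb convergence to
    \<open>z\<close>.\<close>
  define w where "w t = (if t \<in> range (\<lambda>n. fst (q n))
      then snd (q (inv (\<lambda>n. fst (q n)) t)) else z)" for t
  have w_q: "w (fst (q n)) = snd (q n)" for n
    using inv_f_f[OF strict_mono_imp_inj_on[OF sm], of n] by (auto simp: w_def)
  have w_off: "w t = z" if "t \<notin> range (\<lambda>n. fst (q n))" for t
    using that by (simp add: w_def)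
  have wE: "w t \<in> E" for t
    using w_q w_off q \<open>z \<in> E\<close> unfolding Q_def by (cases "t \<in> range (\<lambda>n. fst (q n))") auto
  have "(w \<longlongrightarrow> z) at_top"
  proof (rule tendstoI)
    fix d :: real assume "d > 0"
    then obtain N where N: "inverse (real (Suc N)) < d"
      using reals_Archimedean by blast
    show "\<forall>\<^sub>F t in at_top. dist (w t) z < d"
      using eventually_ge_at_top[of "fst (q N)"]
    proof eventually_elim
      case (elim t)
      show ?case
      proof (cases "t \<in> range (\<lambda>n. fst (q n))")
        case True
        then obtain n where n: "t = fst (q n)" by auto
        with elim have "N \<le> n" using strict_mono_less_eq[OF sm] by simp
        then have "inverse (real (Suc n)) \<le> inverse (real (Suc N))"
          by (intro le_imp_inverse_le) auto
        moreover have "dist (w t) z < inverse (real (Suc n))"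
          using q[of n] n w_q unfolding Q_def by simp
        ultimately show ?thesis using N by linarith
      qed (use w_off \<open>d > 0\<close> in simp)
    qed
  qed
  from tendstoD[OF conv[OF wE this] \<open>e > 0\<close>]
  obtain T where T: "\<And>t. t \<ge> T \<Longrightarrow> dist (H t (w t)) l < e"
    unfolding eventually_at_top_linorder by blast
  obtain n where "real n \<ge> T" using real_arch_simple by blast
  with q[of n] T[of "fst (q n)"] w_q[of n] show False
    unfolding Q_def by auto
qed

lemma joint_limit_seq:
  assumes "((\<lambda>(t, x). H t x) \<longlongrightarrow> l) (at_top \<times>\<^sub>F inf (nhds z) (principal E))"
    and "filterlim u at_top F" and "(w \<longlongrightarrow> z) F" and "\<forall>\<^sub>F k in F. w k \<in> E"
  shows "((\<lambda>k. H (u k) (w k)) \<longlongrightarrow> l) F"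
proof -
  have "filterlim (\<lambda>k. (u k, w k)) (at_top \<times>\<^sub>F inf (nhds z) (principal E)) F"
    using assms(2-4) by (intro filterlim_Pair) (simp_all add: filterlim_inf filterlim_principal)
  from filterlim_compose[OF assms(1) this] show ?thesis by simp
qed

text \<open>Continuity comes from joint convergence alone: for large \<open>t\<close>,
  \<open>H t x\<close> is within \<open>e / 2\<close> of \<open>l z\<close> for all \<open>x\<close>
  in \<open>E\<close> near \<open>z\<close>, and letting \<open>t\<close> grow with \<open>x\<close>
  fixed carries this bound over to \<open>l x\<close>.\<close>

lemma joint_limit_continuous_on:
  fixes H :: "real \<Rightarrow> 'a::metric_space \<Rightarrow> 'b::metric_space"
  assumes conv: "\<And>z. z \<in> A \<Longrightarrow>
      ((\<lambda>(t, x). H t x) \<longlongrightarrow> l z) (at_top \<times>\<^sub>F inf (nhds z) (principal E))"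
    and "A \<subseteq> E"
  shows "continuous_on A l"
  unfolding continuous_on_iff
proof (intro ballI allI impI)
  fix z and e :: real assume z: "z \<in> A" and e: "e > 0"
  have "\<forall>\<^sub>F p in at_top \<times>\<^sub>F inf (nhds z) (principal E). dist ((\<lambda>(t, x). H t x) p) (l z) < e / 2"
    using tendstoD[OF conv[OF z], of "e / 2"] e by simp
  then obtain PT PX where PT: "eventually PT at_top" 
    and PX: "eventually PX (inf (nhds z) (principal E))"
    and lt: "\<And>t x. PT t \<Longrightarrow> PX x \<Longrightarrow> dist (H t x) (l z) < e / 2"
    unfolding eventually_prod_filter by auto
  from PX obtain d where "d > 0" and d: "\<And>x. dist x z < d \<Longrightarrow> x \<in> E \<Longrightarrow> PX x"
    unfolding eventually_inf_principal eventually_nhds_metric by blast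
  have "dist (l x) (l z) < e" if x: "x \<in> A" "dist x z < d" for x
  proof -
    have "((\<lambda>t. H t x) \<longlongrightarrow> l x) at_top"
      using joint_limit_seq[OF conv[OF x(1)], of "\<lambda>t. t" at_top "\<lambda>_. x"] x assms(2)
      by (auto simp: filterlim_ident)
    then have "((\<lambda>t. dist (H t x) (l z)) \<longlongrightarrow> dist (l x) (l z)) at_top"
      by (intro tendsto_intros)
    moreover have "\<forall>\<^sub>F t in at_top. dist (H t x) (l z) \<le> e / 2"
      using PT by eventually_elim (use lt d x assms(2) in \<open>force intro: less_imp_le\<close>)
    ultimately have "dist (l x) (l z) \<le> e / 2"
      by (rule tendsto_upperbound) simp
    with e show ?thesis by simp
  qed
  with \<open>d > 0\<close> show "\<exists>d>0. \<forall>x\<in>A. dist x z < d \<longrightarrow> dist (l x) (l z) < e" by blast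
qed

text \<open>If the limit failed, \<open>h\<close> would leave some neighbourhood of \<open>l\<close>
  along parameters tending to infinity, and no subsequence of them could give the limit
  \<open>l\<close>. The predicate \<open>Q\<close> restricts attention to parameters where a
  selection really is a maximizer.\<close>

lemma tendsto_at_top_subsequenceI:
  fixes h :: "real \<Rightarrow> 'b::topological_space"
  assumes ev: "eventually Q at_top"
    and sub: "\<And>u. filterlim u at_top sequentially \<Longrightarrow> (\<And>k. Q (u k)) \<Longrightarrow>
      \<exists>r. strict_mono (r :: nat \<Rightarrow> nat) \<and> (\<lambda>k. h (u (r k))) \<longlonglongrightarrow> l"
  shows "(h \<longlongrightarrow> l) at_top"
proof (rule topological_tendstoI, rule ccontr)
  fix V assume V: "open V" "l \<in> V" and "\<not> (\<forall>\<^sub>F u in at_top. h u \<in> V)"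
  then have "\<exists>\<^sub>F u in at_top. h u \<notin> V"
    by (simp add: frequently_def)
  have "\<exists>u. u \<ge> real n \<and> h u \<notin> V \<and> Q u" for n
    using frequently_ex[OF frequently_eventually_frequently[OF
        \<open>\<exists>\<^sub>F u in at_top. h u \<notin> V\<close> eventually_conj[OF ev eventually_ge_at_top[of "real n"]]]]
    by blast
  then obtain u where u: "\<And>n. u n \<ge> real n" "\<And>n. h (u n) \<notin> V" "\<And>n. Q (u n)"
    by metis
  have "filterlim u at_top sequentially"
    by (rule filterlim_at_top_mono[OF filterlim_real_sequentially]) (simp add: u)
  from sub[OF this u(3)] obtain r where "(\<lambda>k. h (u (r k))) \<longlonglongrightarrow> l" by blast
  from topological_tendstoD[OF this V] u(2) show False by simp
qed

section \<open>Limits of constrained maximizers\<close>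

text \<open>This isolates what the two density families share, so that the variational argument is
  carried out once. In \<open>recovery\<close> each approximating point \<open>v n\<close> stays
  fixed while \<open>u\<close> grows: the limit in \<open>u\<close> is taken first, the limit in
  \<open>n\<close> afterwards.\<close>

locale maximization_limit =
  fixes E S :: "'a::euclidean_space set" and \<Gamma> :: "real \<Rightarrow> 'a set"
    and \<phi> :: "'a \<Rightarrow> real" and g :: "real \<Rightarrow> 'a \<Rightarrow> real"
  assumes feasible_subset: "\<forall>\<^sub>F u in at_top. \<Gamma> u \<subseteq> E"
    and limit_nonempty: "S \<noteq> {}"
    and limit_subset: "S \<subseteq> E - {0}"
    and outer_subset: "outer_limit \<Gamma> \<subseteq> S"
    and recovery: "y \<in> S \<Longrightarrow>
      \<exists>v. v \<longlonglongrightarrow> y \<and> (\<forall>n. v n \<in> E - {0} \<and> (\<forall>\<^sub>F u in at_top. v n \<in> \<Gamma> u))"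
    and limit_positive: "z \<in> E - {0} \<Longrightarrow> \<phi> z > 0"
    and converges: "z \<in> E - {0} \<Longrightarrow>
      ((\<lambda>(u, x). g u x) \<longlongrightarrow> \<phi> z) (at_top \<times>\<^sub>F inf (nhds z) (principal E))"
    and tight: "\<epsilon> > 0 \<Longrightarrow> \<exists>M. \<forall>\<^sub>F u in at_top. \<forall>z\<in>E. norm z \<ge> M \<longrightarrow> g u z < \<epsilon>"
begin

lemma converges_seq:
  assumes "z \<in> E - {0}" "filterlim u at_top F" "(w \<longlongrightarrow> z) F" "\<forall>\<^sub>F k in F. w k \<in> E"
  shows "((\<lambda>k. g (u k) (w k)) \<longlongrightarrow> \<phi> z) F"
  using joint_limit_seq[OF converges[OF assms(1)] assms(2-4)] .

lemma seq_in_domain: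
  assumes "filterlim u at_top F" "\<And>k. w k \<in> argmax_set (\<Gamma> (u k)) (g (u k))"
  shows "\<forall>\<^sub>F k in F. w k \<in> E"
  using eventually_compose_filterlim[OF feasible_subset assms(1)]
  by eventually_elim (use assms(2) in \<open>auto simp: argmax_set_def is_arg_max_def\<close>)

text \<open>For fixed \<open>n\<close>, the maximizer \<open>w k\<close> eventually beats the
  feasible point \<open>v n\<close>; the limit in \<open>k\<close> gives
  \<open>\<phi> (v n) \<le> \<phi> z\<close>. Continuity of \<open>\<phi>\<close> away from the
  origin then passes from \<open>v n\<close> to an arbitrary competitor \<open>y\<close>.\<close>

lemma outer_limit_argmax:
  "outer_limit (\<lambda>u. argmax_set (\<Gamma> u) (g u)) \<subseteq> argmax_set S \<phi>"
proof
  fix z assume "z \<in> outer_limit (\<lambda>u. argmax_set (\<Gamma> u) (g u))"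
  then obtain u w where u: "filterlim u at_top sequentially"
    and w: "\<And>k. w k \<in> argmax_set (\<Gamma> (u k)) (g (u k))" and lim: "w \<longlonglongrightarrow> z"
    unfolding outer_limit_def by blast
  have "\<And>k. w k \<in> \<Gamma> (u k)"
    using w by (auto simp: argmax_set_def is_arg_max_def)
  with u lim have zS: "z \<in> S"
    using outer_subset unfolding outer_limit_def by blast
  then have "z \<in> E - {0}" using limit_subset by blast
  then have gw: "(\<lambda>k. g (u k) (w k)) \<longlonglongrightarrow> \<phi> z"
    using converges_seq u lim seq_in_domain[OF u w] by blast
  have cont: "continuous_on (E - {0}) \<phi>"
    using joint_limit_continuous_on[OF converges, of "E - {0}"] by blast
  have "\<phi> y \<le> \<phi> z" if y: "y \<in> S" for y
  proof -
    obtain v where v: "v \<longlonglongrightarrow> y" "\<And>n. v n \<in> E - {0}" "\<And>n. \<forall>\<^sub>F u in at_top. v n \<in> \<Gamma> u"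
      using recovery[OF y] by blast
    have le: "\<phi> (v n) \<le> \<phi> z" for n
    proof (rule tendsto_le[OF _ gw])
      show "(\<lambda>k. g (u k) (v n)) \<longlonglongrightarrow> \<phi> (v n)"
        using converges_seq[OF v(2) u, of "\<lambda>_. v n"] v(2) by auto
      show "\<forall>\<^sub>F k in sequentially. g (u k) (v n) \<le> g (u k) (w k)"
        using eventually_compose_filterlim[OF v(3) u]
        by eventually_elim (use w in \<open>auto simp: argmax_set_def is_arg_max_linorder\<close>)
    qed simp
    have "y \<in> E - {0}" using y limit_subset by blast
    then have "(\<lambda>n. \<phi> (v n)) \<longlonglongrightarrow> \<phi> y"
      using continuous_on_tendsto_compose[OF cont v(1)] v(2) by simp
    then show ?thesis
      by (rule LIMSEQ_le_const2) (use le in blast)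
  qed
  with zS show "z \<in> argmax_set S \<phi>"
    by (auto simp: argmax_set_def is_arg_max_linorder)
qed

text \<open>Compactness step: a fixed, eventually feasible point \<open>v\<close> keeps the maximal
  values above a positive constant, whereas tightness makes values far out smaller than that
  constant. Hence the maximizers are eventually bounded.\<close>

lemma argmax_subsequence:
  assumes u: "filterlim u at_top sequentially"
    and w: "\<And>k. w k \<in> argmax_set (\<Gamma> (u k)) (g (u k))"
  obtains z and r :: "nat \<Rightarrow> nat" where "z \<in> argmax_set S \<phi>" "strict_mono r" "(\<lambda>k. w (r k)) \<longlonglongrightarrow> z"
    "(\<lambda>k. g (u (r k)) (w (r k))) \<longlonglongrightarrow> \<phi> z"
proof -
  obtain v where v: "v \<in> E - {0}" "\<forall>\<^sub>F u in at_top. v \<in> \<Gamma> u"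
    using limit_nonempty recovery by blast
  \<comment> \<open>Any level strictly between 0 and \<open>\<phi> v\<close> would do.\<close>
  define c where "c = \<phi> v / 2"
  have c: "0 < c" "c < \<phi> v" using limit_positive[OF v(1)] by (auto simp: c_def)
  obtain M where M: "\<forall>\<^sub>F u in at_top. \<forall>z\<in>E. norm z \<ge> M \<longrightarrow> g u z < c"
    using tight[OF c(1)] by blast
  have "(\<lambda>k. g (u k) v) \<longlonglongrightarrow> \<phi> v"
    using converges_seq[OF v(1) u, of "\<lambda>_. v"] v(1) by auto
  from order_tendstoD(1)[OF this c(2)]
    eventually_compose_filterlim[OF v(2) u] eventually_compose_filterlim[OF M u]
    seq_in_domain[OF u w]
  have "\<forall>\<^sub>F k in sequentially. norm (w k) \<le> M"
  proof eventually_elim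
    case (elim k)
    have "g (u k) v \<le> g (u k) (w k)"
      using w elim by (auto simp: argmax_set_def is_arg_max_linorder)
    with elim show ?case by force
  qed
  \<comment> \<open>The bound holds only eventually, so the first \<open>k0\<close> terms are
    dropped; \<open>r\<close> below absorbs this shift.\<close>
  then obtain k0 where k0: "\<And>k. k \<ge> k0 \<Longrightarrow> norm (w k) \<le> M"
    unfolding eventually_sequentially by blast
  then have "bounded (range (\<lambda>k. w (k + k0)))"
    unfolding bounded_iff by (intro exI[of _ M]) auto
  from bounded_imp_convergent_subsequence[OF this]
  obtain z q where q: "strict_mono q" and lim: "(\<lambda>k. w (q k + k0)) \<longlonglongrightarrow> z"
    by (auto simp: o_def)
  define r where "r k = q k + k0" for k
  have r: "strict_mono r" using q by (simp add: r_def strict_mono_def)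
  have lim': "(\<lambda>k. w (r k)) \<longlonglongrightarrow> z" using lim by (simp add: r_def)
  have ur: "filterlim (\<lambda>k. u (r k)) at_top sequentially"
    using filterlim_compose[OF u filterlim_subseq[OF r]] .
  have "z \<in> outer_limit (\<lambda>u. argmax_set (\<Gamma> u) (g u))"
    unfolding outer_limit_def mem_Collect_eq
    by (intro exI[of _ "\<lambda>k. u (r k)"] exI[of _ "\<lambda>k. w (r k)"]) (simp add: ur w lim')
  then have z: "z \<in> argmax_set S \<phi>" using outer_limit_argmax by blast
  then have "z \<in> E - {0}" using limit_subset by (auto simp: argmax_set_def is_arg_max_def)
  from converges_seq[OF this ur lim' seq_in_domain[OF ur w]] show thesis
    using that z r lim' by blast
qed

text \<open>Subsequences of the selection may approach different maximizers of
  \<open>\<phi>\<close>, but all of these share the same value, so the whole family of values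
  converges.\<close>

lemma argmax_value_tendsto:
  assumes "\<forall>\<^sub>F u in at_top. w u \<in> argmax_set (\<Gamma> u) (g u)" and "z \<in> argmax_set S \<phi>"
  shows "((\<lambda>u. g u (w u)) \<longlongrightarrow> \<phi> z) at_top"
proof (rule tendsto_at_top_subsequenceI[OF assms(1)])
  fix u :: "nat \<Rightarrow> real"
  assume u: "filterlim u at_top sequentially" "\<And>k. w (u k) \<in> argmax_set (\<Gamma> (u k)) (g (u k))"
  obtain y and r :: "nat \<Rightarrow> nat" where y: "y \<in> argmax_set S \<phi>" and r: "strict_mono r"
    and lim: "(\<lambda>k. g (u (r k)) (w (u (r k)))) \<longlonglongrightarrow> \<phi> y"
    using argmax_subsequence[OF u] .
  have "\<phi> y = \<phi> z"
    using assms(2) y unfolding argmax_set_def is_arg_max_linorder mem_Collect_eq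
    by (metis antisym)
  with r lim show "\<exists>r. strict_mono (r :: nat \<Rightarrow> nat) \<and> (\<lambda>k. g (u (r k)) (w (u (r k)))) \<longlonglongrightarrow> \<phi> z"
    by (intro exI[of _ r]) simp
qed

lemma argmax_tendsto:
  assumes "\<forall>\<^sub>F u in at_top. w u \<in> argmax_set (\<Gamma> u) (g u)" and "argmax_set S \<phi> = {z}"
  shows "(w \<longlongrightarrow> z) at_top"
proof (rule tendsto_at_top_subsequenceI[OF assms(1)])
  fix u :: "nat \<Rightarrow> real"
  assume u: "filterlim u at_top sequentially" "\<And>k. w (u k) \<in> argmax_set (\<Gamma> (u k)) (g (u k))"
  show "\<exists>r. strict_mono (r :: nat \<Rightarrow> nat) \<and> (\<lambda>k. w (u (r k))) \<longlonglongrightarrow> z"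
    by (rule argmax_subsequence[OF u]) (use assms(2) in auto)
qed

lemma limit_argmax_nonempty:
  assumes "\<forall>\<^sub>F u in at_top. argmax_set (\<Gamma> u) (g u) \<noteq> {}"
  shows "argmax_set S \<phi> \<noteq> {}"
proof -
  obtain T where T: "\<And>u. u \<ge> T \<Longrightarrow> argmax_set (\<Gamma> u) (g u) \<noteq> {}"
    using assms unfolding eventually_at_top_linorder by blast
  \<comment> \<open>The maximum with \<open>T\<close> guarantees a maximizer for every
    \<open>k\<close>, as \<open>argmax_subsequence\<close> demands.\<close>
  define u where "u k = max T (real k)" for k
  have u: "filterlim u at_top sequentially"
    by (rule filterlim_at_top_mono[OF filterlim_real_sequentially]) (simp add: u_def)
  have "(SOME w. w \<in> argmax_set (\<Gamma> (u k)) (g (u k))) \<in> argmax_set (\<Gamma> (u k)) (g (u k))" for k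
    using T[of "u k"] by (simp add: u_def some_in_eq)
  from argmax_subsequence[OF u this] show ?thesis by blast
qed

end

section \<open>Scaled stress sets and homogeneous limit losses\<close>

lemma scaled_stress_set_iff:
  assumes "cone E" "u > 0"
  shows "z \<in> scaled_stress_set E L u J \<longleftrightarrow>
    z \<in> E \<and> (\<forall>j\<in>J. inverse u * L j (u *\<^sub>R z) \<ge> 1)"
proof -
  have "z \<in> scaled_stress_set E L u J \<longleftrightarrow> u *\<^sub>R z \<in> stress_set E L u J"
    unfolding scaled_stress_set_def using assms(2)
    by (auto simp: image_iff intro!: bexI[of _ "u *\<^sub>R z"])
  also have "\<dots> \<longleftrightarrow> u *\<^sub>R z \<in> E \<and> (\<forall>j\<in>J. inverse u * L j (u *\<^sub>R z) \<ge> 1)"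
    using assms(2) by (auto simp: stress_set_def field_simps)
  also have "u *\<^sub>R z \<in> E \<longleftrightarrow> z \<in> E"
    using mem_cone[OF assms(1), of "u *\<^sub>R z" "inverse u"] mem_cone[OF assms(1), of z u] assms(2)
    by auto
  finally show ?thesis .
qed

context
  fixes E :: "(real ^ 'd) set" and K :: nat and L Lstar :: "nat \<Rightarrow> real ^ 'd \<Rightarrow> real"
  assumes cone: "cone E" and system: "asymp_homogeneous_system E K L Lstar"
begin

lemma loss_joint_limit:
  assumes "j \<in> {1..K}" "z \<in> E"
  shows "((\<lambda>(t, x). inverse t * L j (t *\<^sub>R x)) \<longlongrightarrow> Lstar j z)
    (at_top \<times>\<^sub>F inf (nhds z) (principal E))"
proof (rule joint_limit[OF assms(2)])
  fix w :: "real \<Rightarrow> real ^ 'd" assume "\<And>t. w t \<in> E" "(w \<longlongrightarrow> z) at_top"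
  with system assms show "((\<lambda>t. inverse t * L j (t *\<^sub>R w t)) \<longlongrightarrow> Lstar j z) at_top"
    unfolding asymp_homogeneous_system_def by blast
qed

lemma loss_limit_at_point:
  assumes "j \<in> {1..K}" "z \<in> E"
  shows "((\<lambda>t. inverse t * L j (t *\<^sub>R z)) \<longlongrightarrow> Lstar j z) at_top"
  using joint_limit_seq[OF loss_joint_limit[OF assms], of "\<lambda>t. t" at_top "\<lambda>_. z"] assms(2)
  by (simp add: filterlim_ident)

lemma limit_loss_scale:
  assumes j: "j \<in> {1..K}" and z: "z \<in> E" and c: "c > 0"
  shows "Lstar j (c *\<^sub>R z) = c * Lstar j z"
proof (rule tendsto_unique[OF trivial_limit_at_top_linorder])
  have "c *\<^sub>R z \<in> E" using z c cone by (auto simp: cone_def)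
  from loss_limit_at_point[OF j this]
  show "((\<lambda>t. inverse t * L j (t *\<^sub>R c *\<^sub>R z)) \<longlongrightarrow> Lstar j (c *\<^sub>R z)) at_top" .
  \<comment> \<open>Homogeneity is the substitution of \<open>t * c\<close> for \<open>t\<close> in
    the limit at \<open>z\<close>; the normalisation then produces the factor
    \<open>c\<close>.\<close>
  have "filterlim (\<lambda>t. t * c) at_top at_top"
    using c by (rule filterlim_at_top_mult_tendsto_pos[OF tendsto_const _ filterlim_ident])
  from tendsto_mult_left[OF filterlim_compose[OF loss_limit_at_point[OF j z] this], of c]
  show "((\<lambda>t. inverse t * L j (t *\<^sub>R c *\<^sub>R z)) \<longlongrightarrow> c * Lstar j z) at_top"
    using c by (simp add: field_simps)
qed

text \<open>The origin is fixed by scaling, so homogeneity with factor 2 gives a value equal to its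
  own double.\<close>

lemma limit_loss_zero:
  assumes j: "j \<in> {1..K}" and "0 \<in> E"
  shows "Lstar j 0 = 0"
  using limit_loss_scale[OF assms, of 2] by simp

lemma limit_stress_set_nonzero:
  assumes "J \<subseteq> {1..K}" "J \<noteq> {}"
  shows "limit_stress_set E Lstar J \<subseteq> E - {0}"
proof
  fix z assume z: "z \<in> limit_stress_set E Lstar J"
  obtain j where "j \<in> J" using assms(2) by blast
  with z assms(1) limit_loss_zero[of j] show "z \<in> E - {0}"
    unfolding limit_stress_set_def by force
qed

lemma outer_limit_stress_set:
  assumes "closed E" "J \<subseteq> {1..K}"
  shows "outer_limit (\<lambda>u. scaled_stress_set E L u J) \<subseteq> limit_stress_set E Lstar J"
proof
  fix z assume "z \<in> outer_limit (\<lambda>u. scaled_stress_set E L u J)"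
  then obtain u w where u: "filterlim u at_top sequentially"
    and w: "\<And>k. w k \<in> scaled_stress_set E L (u k) J" and lim: "w \<longlonglongrightarrow> z"
    unfolding outer_limit_def by blast
  have ev: "\<forall>\<^sub>F k in sequentially. w k \<in> E \<and> (\<forall>j\<in>J. inverse (u k) * L j (u k *\<^sub>R w k) \<ge> 1)"
    using eventually_compose_filterlim[OF eventually_gt_at_top[of 0] u]
    by eventually_elim (use w scaled_stress_set_iff[OF cone] in blast)
  have wE: "\<forall>\<^sub>F k in sequentially. w k \<in> E" using ev by eventually_elim simp
  have zE: "z \<in> E" by (rule Lim_in_closed_set[OF \<open>closed E\<close> wE _ lim]) simp
  have "Lstar j z \<ge> 1" if "j \<in> J" for j
  proof (rule tendsto_lowerbound)
    show "(\<lambda>k. inverse (u k) * L j (u k *\<^sub>R w k)) \<longlonglongrightarrow> Lstar j z"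
      using joint_limit_seq[OF loss_joint_limit u lim wE] that assms(2) zE by auto
    show "\<forall>\<^sub>F k in sequentially. 1 \<le> inverse (u k) * L j (u k *\<^sub>R w k)"
      using ev by eventually_elim (use that in simp)
  qed simp
  with zE show "z \<in> limit_stress_set E Lstar J" by (simp add: limit_stress_set_def)
qed

text \<open>
  A point of the limit set may lie on its boundary and hence outside every scaled stress set;
  by homogeneity, pushing it slightly outwards makes all the constraints strict.
\<close>

lemma limit_stress_set_recovery:
  assumes "J \<subseteq> {1..K}" "J \<noteq> {}" and y: "y \<in> limit_stress_set E Lstar J"
  shows "\<exists>v. v \<longlonglongrightarrow> y \<and>
    (\<forall>n. v n \<in> E - {0} \<and> (\<forall>\<^sub>F u in at_top. v n \<in> scaled_stress_set E L u J))"
proof -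
  define c where "c n = 1 + inverse (real (Suc n))" for n
  have c1: "c n > 1" for n by (simp add: c_def)
  have y': "y \<in> E - {0}" using limit_stress_set_nonzero[OF assms(1,2)] y by blast
  have vE: "c n *\<^sub>R y \<in> E" for n using y' cone c1[of n] by (auto simp: cone_def)
  have "c \<longlonglongrightarrow> 1"
    using tendsto_add[OF tendsto_const LIMSEQ_inverse_real_of_nat, of 1] by (simp add: c_def[abs_def])
  then have "(\<lambda>n. c n *\<^sub>R y) \<longlonglongrightarrow> y"
    using tendsto_scaleR[OF _ tendsto_const, of c 1 sequentially y] by simp
  moreover have "c n *\<^sub>R y \<in> E - {0}" for n
    using vE y' c1[of n] by auto
  moreover have "\<forall>\<^sub>F u in at_top. c n *\<^sub>R y \<in> scaled_stress_set E L u J" for n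
  proof -
    have "\<forall>\<^sub>F u in at_top. inverse u * L j (u *\<^sub>R c n *\<^sub>R y) > 1" if "j \<in> J" for j
    proof (rule order_tendstoD(1)[OF loss_limit_at_point])
      have "Lstar j y \<ge> 1" using y that by (simp add: limit_stress_set_def)
      then have "1 * 1 < c n * Lstar j y" using c1[of n] by (intro mult_less_le_imp_less) auto
      then show "1 < Lstar j (c n *\<^sub>R y)"
        using limit_loss_scale[of j y "c n"] that assms(1) y' c1[of n] by auto
    qed (use that assms(1) vE in auto)
    \<comment> \<open>Finiteness of \<open>J\<close> lets one threshold for \<open>u\<close> serve
      all constraints.\<close>
    then have "\<forall>\<^sub>F u in at_top. \<forall>j\<in>J. inverse u * L j (u *\<^sub>R c n *\<^sub>R y) > 1"
      using finite_subset[OF assms(1)] by (intro eventually_ball_finite) auto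
    then show ?thesis
      using eventually_gt_at_top[of 0]
      by eventually_elim (use vE in \<open>auto simp: scaled_stress_set_iff[OF cone] intro: less_imp_le\<close>)
  qed
  ultimately show ?thesis by blast
qed

end

section \<open>Regular variation of the original density\<close>

context
  fixes E :: "(real ^ 'd) set" and f :: "real ^ 'd \<Rightarrow> real" and s :: real
    and \<phi> :: "real ^ 'd \<Rightarrow> real"
  assumes closed: "closed E" and cone: "cone E"
    and regular: "density_regular_variation E f s \<phi>"
begin

lemma scaled_density_uniform_limit:
  assumes "compact C" "C \<subseteq> E - {0}"
  shows "uniform_limit C (scaled_density s f) \<phi> at_top"
proof -
  have "scaled_density s f = (\<lambda>t z. t powr (s + real CARD('d)) * f (t *\<^sub>R z))"
    by (intro ext) (simp add: scaled_density_def)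
  then show ?thesis using regular assms unfolding density_regular_variation_def by auto
qed

text \<open>\<open>f\<close> is known to be continuous only outside a ball, but \<open>C\<close>
  keeps a positive distance \<open>d\<close> from the origin. Once \<open>u > r / d\<close>, scaling
  by \<open>u\<close> moves \<open>C\<close> out of that ball, so \<open>\<phi>\<close> is a uniform
  limit of continuous functions on \<open>C\<close>.\<close>

lemma limit_density_continuous_on_compact:
  assumes "compact C" "C \<subseteq> E - {0}"
  shows "continuous_on C \<phi>"
proof (rule uniform_limit_theorem[OF _ scaled_density_uniform_limit[OF assms]])
  obtain r where r: "r > 0" "continuous_on (E - cball 0 r) f"
    using regular unfolding density_regular_variation_def by blast
  have "open (- C)" "0 \<in> - C" using assms compact_imp_closed by auto
  then obtain d where d: "d > 0" "ball 0 d \<subseteq> - C" by (meson openE)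
  then have norm_C: "norm z \<ge> d" if "z \<in> C" for z
    using that by (force simp: not_le[symmetric])
  show "\<forall>\<^sub>F u in at_top. continuous_on C (scaled_density s f u)"
    using eventually_gt_at_top[of "r / d"]
  proof eventually_elim
    case (elim u)
    have "u > 0" using elim r d by (meson divide_pos_pos order_less_trans)
    have "(\<lambda>z. u *\<^sub>R z) ` C \<subseteq> E - cball 0 r"
    proof safe
      fix z assume z: "z \<in> C"
      show "u *\<^sub>R z \<in> E" using z assms(2) cone \<open>u > 0\<close> by (auto simp: cone_def)
      assume "u *\<^sub>R z \<in> cball 0 r"
      then have "u * norm z \<le> r" using \<open>u > 0\<close> by simp
      moreover have "r < u * d" using elim d by (simp add: field_simps)
      moreover have "u * d \<le> u * norm z" using norm_C[OF z] \<open>u > 0\<close> by simp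
      ultimately show False by linarith
    qed
    then show ?case unfolding scaled_density_def
      by (intro continuous_intros continuous_on_compose2[OF r(2)])
  qed
qed simp

lemma scaled_density_joint_limit:
  assumes z: "z \<in> E - {0}"
  shows "((\<lambda>(u, x). scaled_density s f u x) \<longlongrightarrow> \<phi> z)
    (at_top \<times>\<^sub>F inf (nhds z) (principal E))"
proof (rule joint_limit)
  fix w :: "real \<Rightarrow> real ^ 'd" assume wE: "\<And>t. w t \<in> E" and w: "(w \<longlongrightarrow> z) at_top"
  \<comment> \<open>Half the norm of \<open>z\<close> as radius keeps the origin out of
    \<open>C\<close>, while \<open>w\<close> eventually stays inside, so uniform convergence on
    \<open>C\<close> applies along \<open>w\<close>.\<close>
  define C where "C = E \<inter> cball z (norm z / 2)"
  have C: "compact C" "C \<subseteq> E - {0}"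
    using closed z by (auto simp: C_def closed_Int_compact dist_norm)
  have zC: "z \<in> C" using z by (simp add: C_def)
  have "\<forall>\<^sub>F t in at_top. dist (w t) z < norm z / 2" using tendstoD[OF w, of "norm z / 2"] z by simp
  then have wC: "\<forall>\<^sub>F t in at_top. w t \<in> C"
    by eventually_elim (use wE in \<open>simp add: C_def dist_commute\<close>)
  show "((\<lambda>t. scaled_density s f t (w t)) \<longlongrightarrow> \<phi> z) at_top"
  proof (rule Lim_transform)
    show "((\<lambda>t. \<phi> (w t)) \<longlongrightarrow> \<phi> z) at_top"
      by (rule continuous_on_tendsto_compose[OF limit_density_continuous_on_compact[OF C] w zC wC])
    show "((\<lambda>t. scaled_density s f t (w t) - \<phi> (w t)) \<longlongrightarrow> 0) at_top"
    proof (rule tendstoI)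
      fix e :: real assume "e > 0"
      from uniform_limitD[OF scaled_density_uniform_limit[OF C] this] wC
      show "\<forall>\<^sub>F t in at_top. dist (scaled_density s f t (w t) - \<phi> (w t)) 0 < e"
        by eventually_elim (auto simp: dist_real_def)
    qed
  qed
qed (use z in simp)

text \<open>With \<open>p = s + d\<close> and \<open>x\<close> the direction of \<open>z\<close>,
  the scaled density at \<open>(u, z)\<close> is \<open>norm z powr (- p)\<close> times the scaled
  density at \<open>(u * norm z, x)\<close>. Uniform convergence on the unit sphere bounds the
  second factor, and the first decays.\<close>

lemma scaled_density_tight:
  assumes "\<epsilon> > 0"
  shows "\<exists>M. \<forall>\<^sub>F u in at_top. \<forall>z\<in>E. norm z \<ge> M \<longrightarrow> scaled_density s f u z < \<epsilon>"
proof -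
  define p where "p = s + real CARD('d)"
  have p: "p > 0" using regular unfolding density_regular_variation_def p_def
    by (simp add: add_pos_nonneg)
  define C where "C = E \<inter> sphere 0 1"
  have C: "compact C" "C \<subseteq> E - {0}"
    using closed by (auto simp: C_def closed_Int_compact)
  obtain B where B: "B > 0" "\<And>x. x \<in> C \<Longrightarrow> norm (\<phi> x) \<le> B"
    using compact_imp_bounded[OF compact_continuous_image
        [OF limit_density_continuous_on_compact[OF C] C(1)]]
    unfolding bounded_pos by auto
  have "\<forall>\<^sub>F u in at_top. \<forall>x\<in>C. dist (scaled_density s f u x) (\<phi> x) < 1"
    using uniform_limitD[OF scaled_density_uniform_limit[OF C], of 1] by simp
  then obtain T where T: "\<And>u x. u \<ge> T \<Longrightarrow> x \<in> C \<Longrightarrow> dist (scaled_density s f u x) (\<phi> x) < 1"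
    unfolding eventually_at_top_linorder by blast
  \<comment> \<open>In \<open>B + 1\<close>, \<open>B\<close> bounds \<open>\<phi>\<close> on the
    sphere and 1 is the uniform error beyond \<open>T\<close>.\<close>
  have "((\<lambda>M. M powr (- p) * (B + 1)) \<longlongrightarrow> 0 * (B + 1)) at_top"
    using tendsto_neg_powr[OF _ filterlim_ident, of "- p"] p by (intro tendsto_intros) simp_all
  then have "\<forall>\<^sub>F M in at_top. M powr (- p) * (B + 1) < \<epsilon> \<and> M \<ge> 1"
    using assms by (intro eventually_conj order_tendstoD(2) eventually_ge_at_top) auto
  then obtain M where M: "M powr (- p) * (B + 1) < \<epsilon>" "M \<ge> 1"
    using eventually_happens'[OF trivial_limit_at_top_linorder] by blast
  have "\<forall>\<^sub>F u in at_top. \<forall>z\<in>E. norm z \<ge> M \<longrightarrow> scaled_density s f u z < \<epsilon>"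
    using eventually_ge_at_top[of "max T 1"]
  proof eventually_elim
    case (elim u)
    show ?case
    proof (intro ballI impI)
      fix z assume z: "z \<in> E" "norm z \<ge> M"
      define x where "x = inverse (norm z) *\<^sub>R z"
      have nz: "norm z \<ge> 1" using z M by simp
      have "z \<noteq> 0" using nz by auto
      then have x: "x \<in> C" using z mem_cone[OF cone] by (simp add: x_def C_def)
      \<comment> \<open>Since \<open>norm z \<ge> 1\<close>, moving to the parameter
        \<open>u * norm z\<close> cannot fall below the threshold \<open>T\<close>.\<close>
      have "u * 1 \<le> u * norm z" using nz elim by (intro mult_left_mono) auto
      then have "u * norm z \<ge> T" using elim by linarith
      from T[OF this x] B(2)[OF x] have le: "scaled_density s f (u * norm z) x \<le> B + 1"
        by (auto simp: dist_real_def)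
      have "(u * norm z) *\<^sub>R x = u *\<^sub>R z" using nz by (auto simp: x_def)
      then have "scaled_density s f u z = norm z powr (- p) * scaled_density s f (u * norm z) x"
        using \<open>z \<noteq> 0\<close> elim
        by (simp add: scaled_density_def p_def[symmetric] powr_mult powr_minus field_simps)
      also have "\<dots> \<le> norm z powr (- p) * (B + 1)"
        using le by (intro mult_left_mono) auto
      also have "\<dots> \<le> M powr (- p) * (B + 1)"
        using z M p B by (intro mult_right_mono powr_mono2') auto
      also have "\<dots> < \<epsilon>" by (rule M(1))
      finally show "scaled_density s f u z < \<epsilon>" .
    qed
  qed
  then show ?thesis ..
qed

end

section \<open>Density-preserving families\<close>

lemma density_preserving_joint_limit:
  fixes E :: "(real ^ 'd) set"
  assumes "density_preserving E s \<phi> Pu fu" and z: "z \<in> E - {0}"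
  shows "((\<lambda>(u, x). scaled_density s (fu u) u x) \<longlongrightarrow> \<phi> z)
    (at_top \<times>\<^sub>F inf (nhds z) (principal E))"
proof (rule joint_limit)
  fix w :: "real \<Rightarrow> real ^ 'd" assume "\<And>t. w t \<in> E" "(w \<longlongrightarrow> z) at_top"
  with assms show "((\<lambda>u. scaled_density s (fu u) u (w u)) \<longlongrightarrow> \<phi> z) at_top"
    unfolding density_preserving_def by blast
qed (use z in simp)

lemma density_preserving_tight:
  assumes "density_preserving E s \<phi> Pu fu" and "\<epsilon> > 0"
  shows "\<exists>M. \<forall>\<^sub>F u in at_top. \<forall>z\<in>E. norm z \<ge> M \<longrightarrow> scaled_density s (fu u) u z < \<epsilon>"
proof -
  have "((\<lambda>M::real. Limsup at_top (\<lambda>u::real.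
      SUP z\<in>{z \<in> E. norm z \<ge> M}. ereal (scaled_density s (fu u) u z))) \<longlongrightarrow> 0) at_top"
    using assms(1) by (simp add: density_preserving_def)
  from order_tendstoD(2)[OF this, of "ereal \<epsilon>"] assms(2)
  obtain M where "Limsup at_top (\<lambda>u::real.
      SUP z\<in>{z \<in> E. norm z \<ge> M}. ereal (scaled_density s (fu u) u z)) < ereal \<epsilon>"
    by (force simp: eventually_at_top_linorder)
  from Limsup_lessD[OF this]
  have "\<forall>\<^sub>F u in at_top. \<forall>z\<in>E. norm z \<ge> M \<longrightarrow> scaled_density s (fu u) u z < \<epsilon>"
  proof eventually_elim
    case (elim u)
    show ?case
    proof (intro ballI impI)
      fix z assume "z \<in> E" "norm z \<ge> M"
      then have "ereal (scaled_density s (fu u) u z)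
          \<le> (SUP z\<in>{z \<in> E. norm z \<ge> M}. ereal (scaled_density s (fu u) u z))"
        by (intro SUP_upper) simp
      from le_less_trans[OF this elim] show "scaled_density s (fu u) u z < \<epsilon>" by simp
    qed
  qed
  then show ?thesis ..
qed

section \<open>Maximal density values and the conclusion for both laws\<close>

text \<open>Attainment makes the real-valued supremum an actual maximum. The power of
  \<open>u\<close> in front does not depend on the density.\<close>

lemma SUP_eq_scaled_argmax:
  fixes f :: "real ^ 'd \<Rightarrow> real"
  assumes "u > 0" and "a \<in> argmax_set A (scaled_density s f u)"
  shows "(SUP z\<in>A. f (u *\<^sub>R z)) = u powr (- (s + real CARD('d))) * scaled_density s f u a"
proof -
  have a: "a \<in> A" "\<And>z. z \<in> A \<Longrightarrow> f (u *\<^sub>R z) \<le> f (u *\<^sub>R a)"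
    using assms by (auto simp: argmax_set_def is_arg_max_linorder scaled_density_def)
  from a have "(SUP z\<in>A. f (u *\<^sub>R z)) = f (u *\<^sub>R a)"
    by (intro cSup_eq_maximum) auto
  also have "\<dots> = u powr (- (s + real CARD('d))) * scaled_density s f u a"
    using assms(1) by (simp add: scaled_density_def powr_minus del: minus_add_distrib)
  finally show ?thesis .
qed

theorem theorem2:
  fixes E :: "(real ^ 'd) set"
    and P :: "(real ^ 'd) measure" and f :: "real ^ 'd \<Rightarrow> real"
    and s :: real and \<phi> :: "real ^ 'd \<Rightarrow> real"
    and K :: nat and L Lstar :: "nat \<Rightarrow> real ^ 'd \<Rightarrow> real"
    and \<JJ> :: "nat set set" and J :: "nat set"
    and Pu :: "real \<Rightarrow> (real ^ 'd) measure" and fu :: "real \<Rightarrow> real ^ 'd \<Rightarrow> real"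
  assumes "closed E" and "cone E"
    and "law_with_density_on E P f"
    and "density_regular_variation E f s \<phi>"
    and "asymp_homogeneous_system E K L Lstar"
    and "\<JJ> \<subseteq> Pow {1..K} - {{}}"
    and "regular_system E Lstar \<JJ>"
    and "J \<in> \<JJ>"
    and "density_preserving E s \<phi> Pu fu"
    and "\<forall>\<^sub>F u in at_top. stress_maximizers E L s f u J \<noteq> {}"
    and "\<forall>\<^sub>F u in at_top. stress_maximizers E L s (fu u) u J \<noteq> {}"
  shows "outer_limit (\<lambda>u. stress_maximizers E L s f u J) \<subseteq> limit_maximizers E Lstar \<phi> J
    \<and> outer_limit (\<lambda>u. stress_maximizers E L s (fu u) u J) \<subseteq> limit_maximizers E Lstar \<phi> J
    \<and> ((\<lambda>u. (SUP z\<in>scaled_stress_set E L u J. fu u (u *\<^sub>R z)) /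
            (SUP z\<in>scaled_stress_set E L u J. f (u *\<^sub>R z))) \<longlongrightarrow> 1) at_top
    \<and> (\<forall>zstar. limit_maximizers E Lstar \<phi> J = {zstar} \<longrightarrow>
         (\<forall>w. (\<forall>\<^sub>F u in at_top. w u \<in> stress_maximizers E L s f u J) \<longrightarrow> (w \<longlongrightarrow> zstar) at_top) \<and>
         (\<forall>w. (\<forall>\<^sub>F u in at_top. w u \<in> stress_maximizers E L s (fu u) u J) \<longrightarrow> (w \<longlongrightarrow> zstar) at_top))"
proof -
  have J: "J \<subseteq> {1..K}" "J \<noteq> {}" using assms(6,8) by auto
  have feasible: "\<forall>\<^sub>F u in at_top. scaled_stress_set E L u J \<subseteq> E"
    using eventually_gt_at_top[of 0]
    by eventually_elim (use scaled_stress_set_iff[OF assms(2)] in blast)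
  \<comment> \<open>Regularity enters here: a set of nonzero measure cannot be empty.\<close>
  have nonempty: "limit_stress_set E Lstar J \<noteq> {}"
    using assms(7,8) unfolding regular_system_def by fastforce
  have pos: "\<phi> z > 0" if "z \<in> E - {0}" for z
    using assms(4) that unfolding density_regular_variation_def by blast
  have limit: "maximization_limit E (limit_stress_set E Lstar J)
      (\<lambda>u. scaled_stress_set E L u J) \<phi> g"
    if "\<And>z. z \<in> E - {0} \<Longrightarrow> ((\<lambda>(u, x). g u x) \<longlongrightarrow> \<phi> z) (at_top \<times>\<^sub>F inf (nhds z) (principal E))"
      and "\<And>\<epsilon>. \<epsilon> > 0 \<Longrightarrow> \<exists>M. \<forall>\<^sub>F u in at_top. \<forall>z\<in>E. norm z \<ge> M \<longrightarrow> g u z < \<epsilon>" for g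
    by (rule maximization_limit.intro[OF feasible nonempty limit_stress_set_nonzero[OF assms(2,5) J]
          outer_limit_stress_set[OF assms(2,5,1) J(1)]
          limit_stress_set_recovery[OF assms(2,5) J] pos that])
  interpret P: maximization_limit E "limit_stress_set E Lstar J"
    "\<lambda>u. scaled_stress_set E L u J" \<phi> "scaled_density s f"
    using scaled_density_joint_limit[OF assms(1,2,4)] scaled_density_tight[OF assms(1,2,4)]
    by (rule limit)
  interpret Q: maximization_limit E "limit_stress_set E Lstar J"
    "\<lambda>u. scaled_stress_set E L u J" \<phi> "\<lambda>u. scaled_density s (fu u) u"
    using density_preserving_joint_limit[OF assms(9)] density_preserving_tight[OF assms(9)]
    by (rule limit)
  note defs = stress_maximizers_def limit_maximizers_def
  obtain zs where zs: "zs \<in> argmax_set (limit_stress_set E Lstar J) \<phi>"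
    using P.limit_argmax_nonempty assms(10) unfolding defs by blast
  then have "zs \<in> E - {0}"
    using P.limit_subset by (auto simp: argmax_set_def is_arg_max_def)
  then have zpos: "\<phi> zs > 0" by (rule pos)
  \<comment> \<open>Arbitrary maximizers suffice, since only the maximal values enter the
    ratio.\<close>
  define a where "a u = (SOME z. z \<in> stress_maximizers E L s f u J)" for u
  define b where "b u = (SOME z. z \<in> stress_maximizers E L s (fu u) u J)" for u
  have a: "\<forall>\<^sub>F u in at_top. a u \<in> argmax_set (scaled_stress_set E L u J) (scaled_density s f u)"
    using assms(10) by eventually_elim (simp add: a_def some_in_eq flip: stress_maximizers_def)
  have b: "\<forall>\<^sub>F u in at_top.
      b u \<in> argmax_set (scaled_stress_set E L u J) (scaled_density s (fu u) u)"
    using assms(11) by eventually_elim (simp add: b_def some_in_eq flip: stress_maximizers_def)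
  have "((\<lambda>u. scaled_density s (fu u) u (b u) / scaled_density s f u (a u)) \<longlongrightarrow> \<phi> zs / \<phi> zs) at_top"
    using zpos by (intro tendsto_divide P.argmax_value_tendsto[OF a zs]
        Q.argmax_value_tendsto[OF b zs]) simp
  then have "((\<lambda>u. scaled_density s (fu u) u (b u) / scaled_density s f u (a u)) \<longlongrightarrow> 1) at_top"
    using zpos by simp
  moreover have "\<forall>\<^sub>F u in at_top. scaled_density s (fu u) u (b u) / scaled_density s f u (a u) =
      (SUP z\<in>scaled_stress_set E L u J. fu u (u *\<^sub>R z)) /
      (SUP z\<in>scaled_stress_set E L u J. f (u *\<^sub>R z))"
    using a b eventually_gt_at_top[of 0]
  proof eventually_elim
    case (elim u)
    show ?case
      \<comment> \<open>Both suprema carry the same power of \<open>u\<close>, which is nonzero for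
        \<open>u > 0\<close> and cancels.\<close>
      unfolding SUP_eq_scaled_argmax[OF elim(3,1)] SUP_eq_scaled_argmax[OF elim(3,2)]
      using elim(3) by simp
  qed
  ultimately have ratio: "((\<lambda>u. (SUP z\<in>scaled_stress_set E L u J. fu u (u *\<^sub>R z)) /
      (SUP z\<in>scaled_stress_set E L u J. f (u *\<^sub>R z))) \<longlongrightarrow> 1) at_top"
    by (rule Lim_transform_eventually)
  show ?thesis
    unfolding defs
    using P.outer_limit_argmax Q.outer_limit_argmax ratio P.argmax_tendsto Q.argmax_tendsto
    by blast
qed

end
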